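(* Let $n\ge 1$ and let $f:[0,\infty)\to[0,\infty)$ be a concave function. Let $A$ be a positive semidefinite $n\times n$ complex matrix and let $Z$ be an expansive $n\times n$ complex matrix, i.e. $Z^*Z\ge I$. Then, for every symmetric norm $\Vert\cdot\Vert$ on the space of $n\times n$ complex matrices, $$ \Vert f(Z^*AZ)\Vert \le \Vert Z^*f(A)Z\Vert . $$
   Context: All matrices are $n\times n$ complex matrices (equivalently, operators on a finite-dimensional Hilbert space), and $I$ is the identity. For Hermitian $X,Y$, $X\ge Y$ means that $X-Y$ is positive semidefinite. A matrix $Z$ is called expansive if $Z^*Z\ge I$. For a positive semidefinite matrix $X$ and a function $f$ on $[0,\infty)$, $f(X)$ is defined by the usual functional calculus (apply $f$ to the eigenvalues of $X$ in a spectral decomposition). A symmetric norm is a unitarily invariant norm on the space of $n\times n$ complex matrices, that is, a norm satisfying $\Vert X\Vert=\Vert UXV\Vert$ for all matrices $X$ and all unitary matrices $U,V$. *)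

theory Defs
  imports "HOL-Analysis.Analysis"
begin

type_synonym 'n cmat = "complex ^ 'n ^ 'n"

definition ctrans :: "'n::finite cmat \<Rightarrow> 'n cmat"
  where "ctrans X = map_matrix cnj (transpose X)"

definition hermitian :: "'n::finite cmat \<Rightarrow> bool"
  where "hermitian X \<longleftrightarrow> ctrans X = X"

definition unitary :: "'n::finite cmat \<Rightarrow> bool"
  where "unitary U \<longleftrightarrow> ctrans U ** U = mat 1 \<and> U ** ctrans U = mat 1"

(* The inner product of HOL-Analysis on "complex ^ 'n" is the real one,
   so the Hermitian form v* X v is written out; it is real when X is Hermitian. *)
definition psd :: "'n::finite cmat \<Rightarrow> bool"
  where "psd X \<longleftrightarrow> hermitian X \<and> (\<forall>v. 0 \<le> Re (\<Sum>i\<in>UNIV. cnj (v $ i) * (X *v v) $ i))"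

(* Not the componentwise order on vectors. *)
definition loewner_le :: "'n::finite cmat \<Rightarrow> 'n cmat \<Rightarrow> bool"
  where "loewner_le Y X \<longleftrightarrow> hermitian X \<and> hermitian Y \<and> psd (X - Y)"

definition expansive :: "'n::finite cmat \<Rightarrow> bool"
  where "expansive Z \<longleftrightarrow> loewner_le (mat 1) (ctrans Z ** Z)"

definition diag_mat :: "('n \<Rightarrow> real) \<Rightarrow> 'n::finite cmat"
  where "diag_mat d = (\<chi> i j. if i = j then complex_of_real (d i) else 0)"

(* Functional calculus of Hermitian matrices. The result does not depend on the spectral
   decomposition (mat_fun_spectral below). For psd X only the values of f on
   {0..} matter, since all eigenvalues are then nonnegative. *)
definition mat_fun :: "(real \<Rightarrow> real) \<Rightarrow> 'n::finite cmat \<Rightarrow> 'n cmat"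
  where "mat_fun f X =
    (THE Y. \<exists>U d. unitary U \<and> X = U ** diag_mat d ** ctrans U
                  \<and> Y = U ** diag_mat (f \<circ> d) ** ctrans U)"

definition matrix_norm :: "('n::finite cmat \<Rightarrow> real) \<Rightarrow> bool"
  where "matrix_norm N \<longleftrightarrow>
    (\<forall>X. 0 \<le> N X) \<and>
    (\<forall>X. N X = 0 \<longleftrightarrow> X = 0) \<and>
    (\<forall>c X. N (map_matrix (\<lambda>x. c * x) X) = cmod c * N X) \<and>
    (\<forall>X Y. N (X + Y) \<le> N X + N Y)"

definition symmetric_norm :: "('n::finite cmat \<Rightarrow> real) \<Rightarrow> bool"
  where "symmetric_norm N \<longleftrightarrow>
    matrix_norm N \<and> (\<forall>X U V. unitary U \<and> unitary V \<longrightarrow> N X = N (U ** X ** V))"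

lemma diag_mat_mult_right: "(W ** diag_mat d) $ i $ j = W $ i $ j * of_real (d j)"
  by (simp add: matrix_matrix_mult_def diag_mat_def if_distrib cong: if_cong)

lemma diag_mat_mult_left: "(diag_mat d ** W) $ i $ j = of_real (d i) * W $ i $ j"
  by (simp add: matrix_matrix_mult_def diag_mat_def if_distrib [where f = "\<lambda>x. x * _"] cong: if_cong)

lemma spectral_fun_unique:
  assumes U: "unitary U" and V: "unitary V"
    and eq: "U ** diag_mat d ** ctrans U = V ** diag_mat e ** ctrans V"
  shows "U ** diag_mat (f \<circ> d) ** ctrans U = V ** diag_mat (f \<circ> e) ** ctrans V"
proof -
  define W where "W = ctrans V ** U"
  have UU: "ctrans U ** U = mat 1" "U ** ctrans U = mat 1"
    and VV: "ctrans V ** V = mat 1" "V ** ctrans V = mat 1"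
    using U V by (auto simp: unitary_def)
  have "W ** diag_mat d = ctrans V ** (U ** diag_mat d ** ctrans U) ** U"
    by (simp add: W_def UU flip: matrix_mul_assoc)
  also have "\<dots> = (ctrans V ** V) ** diag_mat e ** W"
    by (simp add: eq W_def matrix_mul_assoc)
  finally have "W ** diag_mat d = diag_mat e ** W"
    by (simp add: VV)
  then have "W $ i $ j * of_real (d j) = of_real (e i) * W $ i $ j" for i j
    by (metis diag_mat_mult_left diag_mat_mult_right)
  then have "W $ i $ j = 0 \<or> d j = e i" for i j
    by (metis mult.commute mult_cancel_left of_real_eq_iff)
  then have "W $ i $ j * of_real (f (d j)) = of_real (f (e i)) * W $ i $ j" for i j
    by (metis mult.commute mult_zero_left)
  then have W: "W ** diag_mat (f \<circ> d) = diag_mat (f \<circ> e) ** W"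
    by (simp add: vec_eq_iff diag_mat_mult_left diag_mat_mult_right)
  have "U ** diag_mat (f \<circ> d) ** ctrans U = V ** (W ** diag_mat (f \<circ> d)) ** ctrans U"
    by (simp add: W_def matrix_mul_assoc VV)
  also have "\<dots> = V ** diag_mat (f \<circ> e) ** ctrans V ** (U ** ctrans U)"
    by (simp only: W) (simp add: W_def matrix_mul_assoc)
  finally show ?thesis
    by (simp add: UU)
qed

lemma mat_fun_spectral:
  assumes "unitary U"
  shows "mat_fun f (U ** diag_mat d ** ctrans U) = U ** diag_mat (f \<circ> d) ** ctrans U"
  unfolding mat_fun_def
  using assms by (intro the_equality) (blast, metis spectral_fun_unique)

end

theory Submission
  imports Defs
begin

text \<open>Let \<open>B = Z\<^sup>* A Z\<close> have the eigenvalues \<open>\<mu>\<^sub>1 \<ge> \<mu>\<^sub>2 \<ge> \<dots>\<close> with orthonormal eigenvectors \<open>u\<^sub>j\<close>, and let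
  \<open>a\<^sub>1 \<ge> a\<^sub>2 \<ge> \<dots>\<close> be the eigenvalues of \<open>A\<close>. The idea is to look at the matrix \<open>Z\<^sup>* f(A) Z\<close> in the
  eigenbasis of \<open>B\<close>, and to keep only its diagonal entries \<open>y\<^sub>j = \<langle>Z u\<^sub>j, f(A) Z u\<^sub>j\<rangle>\<close>. Passing to the
  diagonal does not increase a symmetric norm (\<open>pinching\<close>), and a symmetric norm of diagonal
  matrices is monotone under weak majorization (\<open>diag_norm_mono_weak_majorization\<close>). So it is
  enough to show that \<open>f \<mu>\<^sub>1 + \<dots> + f \<mu>\<^sub>k \<le> y\<^sub>1 + \<dots> + y\<^sub>k\<close> for every \<open>k\<close>; the numbers \<open>f \<mu>\<^sub>j\<close> are
  decreasing because a nonnegative concave function on the half-line is increasing.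

  Write \<open>f t = f 0 + t * h t\<close>. By concavity the slope \<open>h\<close> is decreasing. It is
  singular at 0; as only finitely many arguments matter, it may be frozen below the smallest
  positive one. Since
  \<open>\<langle>Z u\<^sub>j, A Z u\<^sub>l\<rangle> = \<langle>u\<^sub>j, B u\<^sub>l\<rangle>\<close>, the vectors \<open>q\<^sub>j = A\<^sup>1\<^sup>/\<^sup>2 Z u\<^sub>j / sqrt \<mu>\<^sub>j\<close> with \<open>\<mu>\<^sub>j > 0\<close> are
  orthonormal, and \<open>y\<^sub>j = f 0 * \<parallel>Z u\<^sub>j\<parallel>\<^sup>2 + \<mu>\<^sub>j * \<langle>q\<^sub>j, h(A) q\<^sub>j\<rangle>\<close>. The first term is at least \<open>f 0\<close>
  because \<open>Z\<close> is expansive. For the second, as long as \<open>\<mu>\<^sub>k > 0\<close>, \<open>\<langle>q\<^sub>1, h(A) q\<^sub>1\<rangle> + \<dots> + \<langle>q\<^sub>k, h(A) q\<^sub>k\<rangle>\<close> is at least the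
  sum of the \<open>k\<close> smallest eigenvalues of \<open>h(A)\<close>, that is \<open>h a\<^sub>1 + \<dots> + h a\<^sub>k\<close>, and expansiveness
  gives \<open>a\<^sub>j \<le> \<mu>\<^sub>j\<close>, hence \<open>h a\<^sub>j \<ge> h \<mu>\<^sub>j\<close> (\<open>diag_congruence_eigenvalue_le\<close>). Summation by parts
  against the decreasing weights \<open>\<mu>\<^sub>j\<close> finishes the argument (\<open>weighted_concave_sums\<close>).

  In the formal proof both matrices are diagonalized, \<open>A = V D\<^sub>a V\<^sup>*\<close> and \<open>B = U D\<^sub>\<mu> U\<^sup>*\<close>, and
  everything is read off from the entries of \<open>G = V\<^sup>* Z U\<close>, for which \<open>G\<^sup>* D\<^sub>a G = D\<^sub>\<mu>\<close>. The spectral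
  theorem is obtained by maximizing Rayleigh quotients, which yields the eigenvalues in
  decreasing order.\<close>

section \<open>Summation by parts and rearrangement\<close>

text \<open>Summation by parts. A partial sum of \<open>d\<close> is consulted only where \<open>\<mu>\<close> is positive: beyond
  that point the weighted sum no longer changes, and in the application the numbers \<open>d j\<close> carry
  no information there because they come from a division by \<open>\<mu> j\<close>. The induction needs the
  sharper lower bound \<open>\<mu> m * (\<Sum>j<Suc m. d j)\<close> in place of \<open>0\<close>.\<close>

lemma abel_nonneg:
  fixes \<mu> d :: "nat \<Rightarrow> real"
  assumes dec: "\<And>i j. i \<le> j \<Longrightarrow> j < n \<Longrightarrow> \<mu> j \<le> \<mu> i"
    and nn: "\<And>j. j < n \<Longrightarrow> 0 \<le> \<mu> j"
    and S: "\<And>m. m < n \<Longrightarrow> 0 < \<mu> m \<Longrightarrow> 0 \<le> (\<Sum>j<Suc m. d j)"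
    and k: "k \<le> n"
  shows "0 \<le> (\<Sum>j<k. \<mu> j * d j)"
proof -
  have S': "0 \<le> \<mu> m * (\<Sum>j<Suc m. d j)" if "m < n" for m
    using S[OF that] nn[OF that] by (cases "\<mu> m = 0") auto
  have main: "\<mu> m * (\<Sum>j<Suc m. d j) \<le> (\<Sum>j<Suc m. \<mu> j * d j)" if "m < n" for m
    using that
  proof (induction m)
    case 0
    then show ?case by simp
  next
    case (Suc m)
    have "\<mu> (Suc m) * (\<Sum>j<Suc m. d j) \<le> \<mu> m * (\<Sum>j<Suc m. d j)"
    proof (cases "\<mu> (Suc m) = 0")
      case True
      then show ?thesis using S'[of m] Suc.prems by simp
    next
      case False
      then have "0 < \<mu> m" using dec[of m "Suc m"] nn[of "Suc m"] Suc.prems by force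
      then show ?thesis using S[of m] dec[of m "Suc m"] Suc.prems by (intro mult_right_mono) auto
    qed
    then show ?case using Suc by (simp add: distrib_left)
  qed
  show ?thesis
  proof (cases k)
    case 0
    then show ?thesis by simp
  next
    case (Suc m)
    then show ?thesis using main[of m] S'[of m] k by simp
  qed
qed

text \<open>Weights between 0 and 1 of total mass \<open>k\<close> give the least value to an increasing sequence when
  all the mass sits on its first \<open>k\<close> terms. As both sides have the same mass,
  subtracting the pivot \<open>b = h (k - 1)\<close> from \<open>h\<close> does not affect their difference, and it
  makes every term of that difference nonnegative.\<close>

lemma weighted_sum_ge_initial_sum:
  fixes h p :: "nat \<Rightarrow> real"
  assumes inc: "\<And>i j. i \<le> j \<Longrightarrow> j < n \<Longrightarrow> h i \<le> h j"
    and p: "\<And>i. i < n \<Longrightarrow> 0 \<le> p i" "\<And>i. i < n \<Longrightarrow> p i \<le> 1"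
    and total: "(\<Sum>i<n. p i) = real k" and k: "k \<le> n"
  shows "(\<Sum>i<k. h i) \<le> (\<Sum>i<n. h i * p i)"
proof -
  define b where "b = h (k - 1)"
  define q where "q i = (if i < k then 1 else 0 :: real)" for i
  have restrict: "(\<Sum>i<n. g i * q i) = (\<Sum>i<k. g i)" for g :: "nat \<Rightarrow> real"
    using k by (intro sum.mono_neutral_cong_right) (auto simp: q_def)
  have "0 \<le> (\<Sum>i<n. (h i - b) * (p i - q i))"
  proof (rule sum_nonneg)
    fix i assume "i \<in> {..<n}"
    then have i: "i < n" by simp
    show "0 \<le> (h i - b) * (p i - q i)"
    proof (cases "i < k")
      case True
      then have "h i \<le> b" using inc[of i "k - 1"] k by (simp add: b_def)
      then show ?thesis using p(2)[OF i] True by (intro mult_nonpos_nonpos) (auto simp: q_def)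
    next
      case False
      then have "b \<le> h i" using inc[of "k - 1" i] i by (simp add: b_def)
      then show ?thesis using p(1)[OF i] False by (intro mult_nonneg_nonneg) (auto simp: q_def)
    qed
  qed
  also have "\<dots> = (\<Sum>i<n. h i * p i) - (\<Sum>i<n. h i * q i) - b * ((\<Sum>i<n. p i) - (\<Sum>i<n. 1 * q i))"
    by (simp add: algebra_simps sum.distrib sum_subtractf sum_distrib_left)
  also have "\<dots> = (\<Sum>i<n. h i * p i) - (\<Sum>i<k. h i)"
    unfolding restrict using total by simp
  finally show ?thesis by simp
qed

lemma ex_antimono_reordering:
  fixes g :: "nat \<Rightarrow> real"
  obtains \<pi> where "bij_betw \<pi> {..<n} {..<n}"
    and "\<And>i j. i \<le> j \<Longrightarrow> j < n \<Longrightarrow> g (\<pi> j) \<le> g (\<pi> i)"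
proof -
  define xs where "xs = sort_key (\<lambda>i. - g i) [0..<n]"
  have len: "length xs = n" by (simp add: xs_def)
  have "distinct xs" "set xs = {..<n}" by (auto simp: xs_def)
  then have 1: "bij_betw (\<lambda>i. xs ! i) {..<n} {..<n}"
    by (intro bij_betw_nth) (auto simp: len)
  have sorted: "sorted (map (\<lambda>i. - g i) xs)" by (simp add: xs_def)
  have "g (xs ! j) \<le> g (xs ! i)" if "i \<le> j" "j < n" for i j
    using sorted_nth_mono[OF sorted that(1)] that len by simp
  with 1 show thesis by (rule that)
qed

text \<open>The linear form of weak majorization. Here \<open>x\<close> is decreasing, whereas \<open>y\<close> may be unsorted.
  Reordering \<open>\<bar>c\<bar>\<close> decreasingly can only increase its partial sums, hence its pairing with \<open>x\<close>;
  after that \<open>c\<close> is the decreasing weight, and the partial sums of \<open>x\<close> and \<open>y\<close> can be compared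
  through it.\<close>

lemma sum_mult_le_reordered:
  fixes c x y :: "nat \<Rightarrow> real"
  assumes x_dec: "\<And>i j. i \<le> j \<Longrightarrow> j < n \<Longrightarrow> x j \<le> x i" and x_nn: "\<And>i. i < n \<Longrightarrow> 0 \<le> x i"
    and le: "\<And>k. k \<le> n \<Longrightarrow> (\<Sum>j<k. x j) \<le> (\<Sum>j<k. y j)"
  obtains \<pi> where "bij_betw \<pi> {..<n} {..<n}"
    and "(\<Sum>j<n. c j * x j) \<le> (\<Sum>j<n. \<bar>c (\<pi> j)\<bar> * y j)"
proof -
  obtain \<pi> where bij: "bij_betw \<pi> {..<n} {..<n}"
    and dec: "\<And>i j. i \<le> j \<Longrightarrow> j < n \<Longrightarrow> \<bar>c (\<pi> j)\<bar> \<le> \<bar>c (\<pi> i)\<bar>"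
    using ex_antimono_reordering[of n "\<lambda>i. \<bar>c i\<bar>"] by blast
  have top: "(\<Sum>j<k. \<bar>c j\<bar>) \<le> (\<Sum>j<k. \<bar>c (\<pi> j)\<bar>)" if k: "k \<le> n" for k
  proof -
    define q where "q i = (if i < k then 1 else 0 :: real)" for i
    have q_sum: "(\<Sum>i<n. g i * q i) = (\<Sum>i<k. g i)" for g
      using k by (intro sum.mono_neutral_cong_right) (auto simp: q_def)
    have reindex: "(\<Sum>i<n. g (\<pi> i) * q (\<pi> i)) = (\<Sum>i<k. g i)" for g
      using sum.reindex_bij_betw[OF bij, of "\<lambda>i. g i * q i"] q_sum by simp
    have "(\<Sum>i<k. - \<bar>c (\<pi> i)\<bar>) \<le> (\<Sum>i<n. - \<bar>c (\<pi> i)\<bar> * q (\<pi> i))"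
      using dec k reindex[of "\<lambda>_. 1"]
      by (intro weighted_sum_ge_initial_sum) (auto simp: q_def)
    then show ?thesis using reindex[of "\<lambda>i. \<bar>c i\<bar>"] by (simp add: sum_negf)
  qed
  have "0 \<le> (\<Sum>j<n. x j * (\<bar>c (\<pi> j)\<bar> - \<bar>c j\<bar>))"
    using x_dec x_nn top
    by (intro abel_nonneg[where n = n])
      (auto simp only: sum_subtractf diff_ge_0_iff_ge Suc_le_eq order_refl)
  moreover have "0 \<le> (\<Sum>j<n. \<bar>c (\<pi> j)\<bar> * (y j - x j))"
    using dec le
    by (intro abel_nonneg[where n = n])
      (auto simp only: sum_subtractf diff_ge_0_iff_ge Suc_le_eq order_refl abs_ge_zero)
  moreover have "(\<Sum>j<n. c j * x j) \<le> (\<Sum>j<n. \<bar>c j\<bar> * x j)"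
    using x_nn by (intro sum_mono mult_right_mono) auto
  ultimately have "(\<Sum>j<n. c j * x j) \<le> (\<Sum>j<n. \<bar>c (\<pi> j)\<bar> * y j)"
    by (simp add: algebra_simps sum_subtractf)
  with bij show thesis by (rule that)
qed

section \<open>Concave functions and weighted sums\<close>

text \<open>If \<open>f\<close> decreased between two points, concavity would force it below zero far to the right;
  \<open>u\<close> is a point far enough for a contradiction.\<close>

lemma concave_nonneg_mono:
  fixes f :: "real \<Rightarrow> real"
  assumes conc: "concave_on {0..} f" and nonneg: "\<And>x. 0 \<le> x \<Longrightarrow> 0 \<le> f x"
    and "0 \<le> s" "s \<le> t"
  shows "f s \<le> f t"
proof (rule ccontr)
  assume "\<not> f s \<le> f t"
  \<comment> \<open>The weight for which \<open>(1 - l) * f s\<close> is the midpoint of \<open>f s\<close> and \<open>f t\<close>.\<close>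
  define l where "l = (f s - f t) / (2 * f s)"
  have fs: "0 < f s" and lt: "f t < f s" and ft: "0 \<le> f t"
    using \<open>\<not> f s \<le> f t\<close> nonneg[of t] assms(3,4) by auto
  have l: "0 < l" "l \<le> 1" using fs lt ft by (auto simp: l_def field_simps)
  define u where "u = s + (t - s) / l"
  have u: "0 \<le> u" using l assms by (simp add: u_def)
  have "(1 - l) * f s + l * f u \<le> f ((1 - l) *\<^sub>R s + l *\<^sub>R u)"
    using concave_onD[OF conc, of l s u] l u assms by simp
  also have "(1 - l) *\<^sub>R s + l *\<^sub>R u = t"
    using l by (simp add: u_def field_simps)
  finally have "(1 - l) * f s + l * f u \<le> f t" .
  moreover have "0 \<le> l * f u" using l nonneg[OF u] by simp
  ultimately have "(1 - l) * f s \<le> f t" by linarith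
  moreover have "(1 - l) * f s = (f s + f t) / 2" using fs by (simp add: l_def field_simps)
  ultimately show False using lt by simp
qed

lemma concave_slope_antimono:
  fixes f :: "real \<Rightarrow> real"
  assumes conc: "concave_on {0..} f" and st: "0 < s" "s \<le> t"
  shows "(f t - f 0) / t \<le> (f s - f 0) / s"
proof -
  have "(1 - s / t) * f 0 + (s / t) * f t \<le> f ((1 - s / t) *\<^sub>R 0 + (s / t) *\<^sub>R t)"
    using concave_onD[OF conc, of "s / t" 0 t] st by simp
  also have "\<dots> = f s" using st by simp
  finally show ?thesis using st by (simp add: field_simps)
qed

text \<open>The numerical core. Write \<open>f t = f 0 + t * h t\<close> with the decreasing slope function \<open>h\<close>. The
  constant part is handled by \<open>col\<close>. Where \<open>\<mu> j\<close> is positive, the rest of column \<open>j\<close> is \<open>\<mu> j\<close> times an average \<open>c j\<close> of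
  the slopes \<open>h (a i)\<close> with weights \<open>P i j = a i * W i j / \<mu> j\<close>. These columns of \<open>P\<close> sum to 1 and
  the rows to at most 1, so \<open>c 0 + \<dots> + c m\<close> is at least the sum of the \<open>m + 1\<close> smallest slopes, which
  are \<open>h (a 0), \<dots>, h (a m)\<close>. Finally \<open>h (a j) \<ge> h (\<mu> j)\<close> because \<open>a j \<le> \<mu> j\<close>, and summation by
  parts restores the decreasing factors \<open>\<mu> j\<close>.\<close>

lemma weighted_concave_sums:
  fixes f :: "real \<Rightarrow> real" and a \<mu> :: "nat \<Rightarrow> real" and W :: "nat \<Rightarrow> nat \<Rightarrow> real"
  assumes conc: "concave_on {0..} f" and nonneg: "\<And>x. 0 \<le> x \<Longrightarrow> 0 \<le> f x"
    and a_dec: "\<And>i j. i \<le> j \<Longrightarrow> j < n \<Longrightarrow> a j \<le> a i" and a_nn: "\<And>i. i < n \<Longrightarrow> 0 \<le> a i"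
    and mu_dec: "\<And>i j. i \<le> j \<Longrightarrow> j < n \<Longrightarrow> \<mu> j \<le> \<mu> i" and le: "\<And>i. i < n \<Longrightarrow> a i \<le> \<mu> i"
    and W_nn: "\<And>i j. 0 \<le> W i j"
    and mu: "\<And>j. j < n \<Longrightarrow> (\<Sum>i<n. a i * W i j) = \<mu> j"
    and col: "\<And>j. j < n \<Longrightarrow> 1 \<le> (\<Sum>i<n. W i j)"
    and row: "\<And>i. i < n \<Longrightarrow> (\<Sum>j<n. a i * W i j / \<mu> j) \<le> 1"
    and k: "k \<le> n"
  shows "(\<Sum>j<k. f (\<mu> j)) \<le> (\<Sum>j<k. \<Sum>i<n. f (a i) * W i j)"
proof -
  have mu_nn: "0 \<le> \<mu> j" if "j < n" for j using le[OF that] a_nn[OF that] by simp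
  \<comment> \<open>The slope is singular at 0, and may be unbounded near 0. Only finitely many arguments
      occur, so it can be frozen below the smallest positive one, \<open>t0\<close>.\<close>
  define E where "E = insert 1 {t \<in> a ` {..<n} \<union> \<mu> ` {..<n}. 0 < t}"
  define t0 where "t0 = Min E"
  have E: "finite E" "E \<noteq> {}" by (auto simp: E_def)
  have t0: "0 < t0" using Min_in[OF E] by (auto simp: t0_def E_def)
  have t0_a: "t0 \<le> a i" if "i < n" "0 < a i" for i
    unfolding t0_def using that E by (intro Min_le) (auto simp: E_def)
  have t0_mu: "t0 \<le> \<mu> i" if "i < n" "0 < \<mu> i" for i
    unfolding t0_def using that E by (intro Min_le) (auto simp: E_def)
  define h where "h i = (f (max (a i) t0) - f 0) / max (a i) t0" for i
  have h_inc: "h i \<le> h j" if "i \<le> j" "j < n" for i j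
    unfolding h_def using a_dec[OF that] t0 by (intro concave_slope_antimono[OF conc]) auto
  have h_nn: "0 \<le> h i" for i
    unfolding h_def using concave_nonneg_mono[OF conc nonneg, of 0 "max (a i) t0"] t0
    by (intro divide_nonneg_pos) auto
  have f_a: "f (a i) = f 0 + a i * h i" if "i < n" for i
  proof (cases "a i = 0")
    case False
    then have "0 < a i" "t0 \<le> a i" using a_nn[OF that] t0_a[OF that] by auto
    then show ?thesis by (simp add: h_def max_def)
  qed simp
  have f_mu: "f (\<mu> j) \<le> f 0 + \<mu> j * h j" if "j < n" for j
  proof (cases "\<mu> j = 0")
    case False
    then have pos: "0 < \<mu> j" using mu_nn[OF that] by simp
    then have "(f (\<mu> j) - f 0) / \<mu> j \<le> h j"
      unfolding h_def using t0 t0_mu[OF that] le[OF that]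
      by (intro concave_slope_antimono[OF conc]) auto
    then show ?thesis using pos by (simp add: field_simps)
  qed simp
  \<comment> \<open>If \<open>\<mu> j = 0\<close>, column \<open>j\<close> of \<open>P\<close> is zero by the convention for division by zero.\<close>
  define P where "P i j = a i * W i j / \<mu> j" for i j
  have P_nn: "0 \<le> P i j" if "i < n" "j < n" for i j
    using that a_nn mu_nn W_nn by (simp add: P_def)
  define c where "c j = (\<Sum>i<n. h i * P i j)" for j
  have column: "f 0 + \<mu> j * c j \<le> (\<Sum>i<n. f (a i) * W i j)" if "j < n" for j
  proof -
    have "\<mu> j * c j \<le> (\<Sum>i<n. a i * h i * W i j)"
    proof (cases "\<mu> j = 0")
      case True
      then show ?thesis using a_nn h_nn W_nn by (auto intro!: sum_nonneg)
    next
      case False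
      then show ?thesis by (simp add: c_def P_def sum_distrib_left mult_ac)
    qed
    moreover have "f 0 \<le> f 0 * (\<Sum>i<n. W i j)"
      using mult_left_mono[OF col[OF that], of "f 0"] nonneg[of 0] by simp
    moreover have "(\<Sum>i<n. f (a i) * W i j) = f 0 * (\<Sum>i<n. W i j) + (\<Sum>i<n. a i * h i * W i j)"
      by (simp add: f_a sum_distrib_left sum.distrib algebra_simps)
    ultimately show ?thesis by linarith
  qed
  have partial: "0 \<le> (\<Sum>j<Suc m. c j - h j)" if m: "m < n" "0 < \<mu> m" for m
  proof -
    define p where "p i = (\<Sum>j<Suc m. P i j)" for i
    have pos: "0 < \<mu> j" if "j < Suc m" for j using mu_dec[of j m] that m by force
    have "p i \<le> 1" if "i < n" for i
    proof -
      have "p i \<le> (\<Sum>j<n. P i j)"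
        unfolding p_def using m P_nn that by (intro sum_mono2) auto
      then show ?thesis using row[OF that] by (simp add: P_def)
    qed
    moreover have "0 \<le> p i" if "i < n" for i
      unfolding p_def using m P_nn that by (intro sum_nonneg) auto
    moreover have "(\<Sum>i<n. p i) = real (Suc m)"
    proof -
      have "(\<Sum>i<n. p i) = (\<Sum>j<Suc m. \<Sum>i<n. P i j)"
        unfolding p_def by (rule sum.swap)
      also have "\<dots> = (\<Sum>j<Suc m. 1)"
      proof (rule sum.cong)
        fix j assume j: "j \<in> {..<Suc m}"
        then have "(\<Sum>i<n. P i j) = \<mu> j / \<mu> j"
          using mu[of j] m by (simp add: P_def flip: sum_divide_distrib)
        then show "(\<Sum>i<n. P i j) = 1" using pos[of j] j by simp
      qed simp
      finally show ?thesis by simp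
    qed
    ultimately have "(\<Sum>i<Suc m. h i) \<le> (\<Sum>i<n. h i * p i)"
      using m h_inc by (intro weighted_sum_ge_initial_sum) auto
    also have "\<dots> = (\<Sum>j<Suc m. c j)"
      unfolding p_def c_def sum_distrib_left by (rule sum.swap)
    finally show ?thesis by (simp only: sum_subtractf diff_ge_0_iff_ge)
  qed
  have "0 \<le> (\<Sum>j<k. \<mu> j * (c j - h j))"
    by (rule abel_nonneg[where n = n]) (use mu_dec mu_nn partial k in auto)
  then have "(\<Sum>j<k. \<mu> j * h j) \<le> (\<Sum>j<k. \<mu> j * c j)"
    by (simp add: right_diff_distrib sum_subtractf)
  moreover have "(\<Sum>j<k. f (\<mu> j)) \<le> (\<Sum>j<k. f 0 + \<mu> j * h j)"
    using k f_mu by (intro sum_mono) auto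
  moreover have "(\<Sum>j<k. f 0 + \<mu> j * c j) \<le> (\<Sum>j<k. \<Sum>i<n. f (a i) * W i j)"
    using k column by (intro sum_mono) auto
  ultimately show ?thesis by (simp add: sum.distrib)
qed

section \<open>The complex inner product and the spectral theorem\<close>

lemma ctrans_nth [simp]: "ctrans X $ i $ j = cnj (X $ j $ i)"
  by (simp add: ctrans_def map_matrix_def transpose_def)

lemma ctrans_ctrans [simp]: "ctrans (ctrans X) = X"
  by (simp add: vec_eq_iff)

lemma ctrans_mult: "ctrans (X ** Y) = ctrans Y ** ctrans X"
  by (simp add: vec_eq_iff matrix_matrix_mult_def mult.commute)

lemma ctrans_diag_mat [simp]: "ctrans (diag_mat d) = diag_mat d"
  by (simp add: vec_eq_iff diag_mat_def)

lemma unitary_iff: "unitary U \<longleftrightarrow> ctrans U ** U = mat 1"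
  by (auto simp: unitary_def matrix_left_right_inverse)

lemma unitary_ctrans: "unitary U \<Longrightarrow> unitary (ctrans U)"
  by (simp add: unitary_def)

definition cinner :: "complex ^ 'n::finite \<Rightarrow> complex ^ 'n \<Rightarrow> complex"
  where "cinner v w = (\<Sum>i\<in>UNIV. cnj (v $ i) * w $ i)"

lemma cinner_simps:
  "cinner v (x + y) = cinner v x + cinner v y"
  "cinner v (x - y) = cinner v x - cinner v y"
  "cinner v (c *\<^sub>R x) = of_real c * cinner v x"
  "cinner (x + y) w = cinner x w + cinner y w"
  "cinner (c *\<^sub>R x) w = of_real c * cinner x w"
  by (auto simp: cinner_def algebra_simps sum.distrib sum_subtractf sum_distrib_left scaleR_conv_of_real[of _ "_ :: complex"])

lemma cnj_cinner: "cnj (cinner v w) = cinner w v"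
  by (simp add: cinner_def mult.commute)

lemma Re_cinner: "Re (cinner v w) = v \<bullet> w"
  by (simp add: cinner_def inner_vec_def inner_complex_def)

lemma Re_cinner_self: "Re (cinner v v) = (norm v)\<^sup>2"
  by (simp add: Re_cinner power2_norm_eq_inner)

lemma cinner_self: "cinner v v = of_real ((norm v)\<^sup>2)"
proof -
  have "Im (cinner v v) = 0"
    using arg_cong[OF cnj_cinner[of v v], of Im] by simp
  then show ?thesis by (simp add: complex_eq_iff Re_cinner_self)
qed

lemma cinner_matrix: "cinner v (X *v w) = cinner (ctrans X *v v) w"
  unfolding cinner_def matrix_vector_mult_def
  by (simp add: sum_distrib_left sum_distrib_right mult_ac, rule sum.swap)

lemma matrix_vector_mult_scaleR_complex:
  fixes X :: "'n::finite cmat"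
  shows "X *v (c *\<^sub>R v) = c *\<^sub>R (X *v v)"
  by (simp add: vec_eq_iff matrix_vector_mult_def scaleR_sum_right)

lemma psd_iff: "psd X \<longleftrightarrow> hermitian X \<and> (\<forall>v. 0 \<le> Re (cinner v (X *v v)))"
  by (simp add: psd_def cinner_def)

lemma psd_congruence:
  assumes "psd A"
  shows "psd (ctrans Z ** A ** Z)"
proof -
  have "hermitian (ctrans Z ** A ** Z)"
    using assms by (simp add: psd_def hermitian_def ctrans_mult matrix_mul_assoc)
  moreover have "0 \<le> Re (cinner v ((ctrans Z ** A ** Z) *v v))" for v
  proof -
    have "cinner v ((ctrans Z ** A ** Z) *v v) = cinner (Z *v v) (A *v (Z *v v))"
      by (simp add: cinner_matrix[of v "ctrans Z"] flip: matrix_vector_mul_assoc)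
    then show ?thesis using assms by (simp add: psd_iff)
  qed
  ultimately show ?thesis by (simp add: psd_iff)
qed

text \<open>Fewer than \<open>n\<close> complex linear equations have a common unit solution. Counting real dimensions
  gives this: complex orthogonality to \<open>v\<close> is real orthogonality to both \<open>v\<close> and \<open>\<i> v\<close>, and the
  real dimension of the space is \<open>2 n\<close>.\<close>

lemma ex_unit_vector_annihilated:
  fixes S :: "(complex ^ 'n::finite) set"
  assumes "finite S" "card S < CARD('n)"
  obtains x where "norm x = 1" and "\<And>v. v \<in> S \<Longrightarrow> cinner v x = 0"
proof -
  define T where "T = S \<union> (\<lambda>v. \<i> *s v) ` S"
  have "card T \<le> card S + card S"
    unfolding T_def by (rule order_trans[OF card_Un_le]) (simp add: card_image_le assms)
  also have "\<dots> < DIM(complex ^ 'n)" using assms by simp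
  finally have "dim T < DIM(complex ^ 'n)"
    using dim_le_card[of T T] assms span_superset[of T] by (simp add: T_def)
  then obtain x where x: "x \<noteq> 0" "\<And>y. y \<in> span T \<Longrightarrow> orthogonal x y"
    using orthogonal_to_subspace_exists[of T] by blast
  have "cinner v x = 0" if "v \<in> S" for v
  proof -
    have "v \<bullet> x = 0" "(\<i> *s v) \<bullet> x = 0"
      using x(2)[of v] x(2)[of "\<i> *s v"] that span_superset[of T]
      by (auto simp: T_def orthogonal_def inner_commute)
    moreover have "cinner (\<i> *s v) x = - \<i> * cinner v x"
      by (simp add: cinner_def sum_distrib_left mult_ac)
    ultimately show ?thesis
      by (simp add: complex_eq_iff flip: Re_cinner)
  qed
  then show thesis using that[of "x /\<^sub>R norm x"] x(1) by (simp add: cinner_simps)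
qed

text \<open>First-order optimality. Moving from the maximizer \<open>v\<close> in the direction of the residual
  \<open>r = X v - l v\<close> by a step \<open>t\<close> raises the quadratic form of \<open>X - l\<close> by \<open>2 t \<parallel>r\<parallel>\<^sup>2\<close> up to
  order \<open>t\<^sup>2\<close>, so the residual must vanish.\<close>

lemma Rayleigh_maximizer_eigenvector:
  assumes X: "hermitian X"
    and S_add: "\<And>v w. v \<in> S \<Longrightarrow> w \<in> S \<Longrightarrow> v + w \<in> S"
    and S_scale: "\<And>c v. v \<in> S \<Longrightarrow> c *\<^sub>R v \<in> S"
    and S_inv: "\<And>v. v \<in> S \<Longrightarrow> X *v v \<in> S"
    and v: "v \<in> S" "norm v = 1" and l: "l = Re (cinner v (X *v v))"
    and max: "\<And>w. w \<in> S \<Longrightarrow> Re (cinner w (X *v w)) \<le> l * (norm w)\<^sup>2"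
  shows "X *v v = l *\<^sub>R v"
proof -
  define r where "r = X *v v + (- l) *\<^sub>R v"
  have r: "r \<in> S" unfolding r_def using v S_add S_scale S_inv by blast
  define K where "K = (norm r)\<^sup>2"
  define C where "C = l * K - Re (cinner r (X *v r))"
  have lin: "2 * t * K \<le> t\<^sup>2 * C" for t
  proof -
    have "v + t *\<^sub>R r \<in> S" using v r S_add S_scale by blast
    from max[OF this] have
      "Re (cinner (v + t *\<^sub>R r) (X *v (v + t *\<^sub>R r))) \<le> l * Re (cinner (v + t *\<^sub>R r) (v + t *\<^sub>R r))"
      by (simp add: Re_cinner_self)
    moreover have XR: "X *v (t *\<^sub>R r) = t *\<^sub>R (X *v r)"
      by (rule matrix_vector_mult_scaleR_complex)
    moreover have "cinner v (X *v r) = cnj (cinner r (X *v v))"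
      using X by (simp add: cnj_cinner cinner_matrix hermitian_def)
    moreover have "cinner v r = cnj (cinner r v)" by (simp add: cnj_cinner)
    ultimately have
      "l + 2 * t * Re (cinner r (X *v v)) + t\<^sup>2 * Re (cinner r (X *v r))
        \<le> l * (1 + 2 * t * Re (cinner r v) + t\<^sup>2 * K)"
      using v(2) by (simp add: cinner_simps matrix_vector_right_distrib Re_cinner_self
          K_def l algebra_simps power2_eq_square)
    moreover have "Re (cinner r (X *v v)) = K + l * Re (cinner r v)"
    proof -
      have "cinner r (X *v v) = cinner r (r + l *\<^sub>R v)" by (simp add: r_def)
      then show ?thesis by (simp add: cinner_simps Re_cinner_self K_def)
    qed
    ultimately show ?thesis by (simp add: C_def algebra_simps)
  qed
  have "K = 0"
  proof (rule ccontr)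
    assume "K \<noteq> 0"
    then have K: "0 < K" by (simp add: K_def)
    define t where "t = K / (\<bar>C\<bar> + 1)"
    have t: "0 < t" using K by (simp add: t_def)
    then have "2 * K \<le> t * C" using lin[of t] by (simp add: power2_eq_square)
    also have "\<dots> \<le> t * (\<bar>C\<bar> + 1)" using t by (intro mult_left_mono) auto
    also have "\<dots> = K" by (simp add: t_def add_nonneg_pos)
    finally show False using K by simp
  qed
  then show ?thesis by (simp add: K_def r_def add_eq_0_iff)
qed

text \<open>The Rayleigh quotient attains its maximum on the unit sphere of the orthogonal complement of the
  eigenvectors found so far, by compactness. That complement is invariant under \<open>X\<close>, so the
  maximizer is an eigenvector by the preceding lemma.\<close>

lemma ex_next_eigenvector:
  fixes X :: "'n::finite cmat" and u :: "nat \<Rightarrow> complex ^ 'n"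
  assumes X: "hermitian X" and m: "m < CARD('n)"
    and eig: "\<And>i. i < m \<Longrightarrow> X *v u i = \<mu> i *\<^sub>R u i"
  obtains v l where "norm v = 1" "X *v v = l *\<^sub>R v" "\<And>i. i < m \<Longrightarrow> cinner (u i) v = 0"
    "\<And>w. (\<And>i. i < m \<Longrightarrow> cinner (u i) w = 0) \<Longrightarrow> Re (cinner w (X *v w)) \<le> l * (norm w)\<^sup>2"
proof -
  define S where "S = {w. \<forall>i<m. cinner (u i) w = 0}"
  define q where "q w = Re (cinner w (X *v w))" for w
  have S_scale: "c *\<^sub>R v \<in> S" if "v \<in> S" for c v
    using that by (simp add: S_def cinner_simps)
  have q_scale: "q (c *\<^sub>R w) = c\<^sup>2 * q w" for c w
  proof -
    have "X *v (c *\<^sub>R w) = c *\<^sub>R (X *v w)"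
      by (rule matrix_vector_mult_scaleR_complex)
    then show ?thesis by (simp add: q_def cinner_simps power2_eq_square)
  qed
  have "card (u ` {..<m}) < CARD('n)"
    using card_image_le[of "{..<m}" u] m by simp
  then obtain x where x: "norm x = 1" "\<And>v. v \<in> u ` {..<m} \<Longrightarrow> cinner v x = 0"
    using ex_unit_vector_annihilated[of "u ` {..<m}"] by blast
  have "compact (sphere 0 1 \<inter> S)"
  proof (rule compact_Int_closed)
    have "S = (\<Inter>i\<in>{..<m}. {w. cinner (u i) w = 0})" by (auto simp: S_def)
    also have "closed \<dots>"
      by (intro closed_INT ballI closed_Collect_eq) (auto simp: cinner_def intro!: continuous_intros)
    finally show "closed S" .
  qed simp
  moreover have "x \<in> sphere 0 1 \<inter> S" using x by (auto simp: S_def)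
  moreover have "continuous_on (sphere 0 1 \<inter> S) q"
    unfolding q_def cinner_def matrix_vector_mult_def by (auto intro!: continuous_intros)
  ultimately obtain v where v: "v \<in> sphere 0 1 \<inter> S" "\<And>w. w \<in> sphere 0 1 \<inter> S \<Longrightarrow> q w \<le> q v"
    using continuous_attains_sup[of "sphere 0 1 \<inter> S" q] by blast
  have max: "q w \<le> q v * (norm w)\<^sup>2" if "w \<in> S" for w
  proof (cases "w = 0")
    case True
    then show ?thesis by (simp add: q_def cinner_def)
  next
    case False
    then have "q (w /\<^sub>R norm w) \<le> q v"
      using v(2)[of "w /\<^sub>R norm w"] S_scale[OF that] by simp
    then show ?thesis using False by (simp add: q_scale field_simps)
  qed
  have "X *v v = q v *\<^sub>R v"
  proof (rule Rayleigh_maximizer_eigenvector[OF X, of S])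
    show "X *v w \<in> S" if "w \<in> S" for w
      using that X eig by (simp add: S_def cinner_matrix hermitian_def cinner_simps)
  qed (use v max S_scale in \<open>auto simp: q_def S_def cinner_simps\<close>)
  then show thesis
    using that[of v "q v"] v(1) max by (auto simp: S_def q_def)
qed

text \<open>The last clause says that no Rayleigh quotient on the orthogonal complement of the first
  \<open>m\<close> eigenvectors exceeds the eigenvalues found so far. It is what keeps the list of
  eigenvalues decreasing when a maximizer on that complement is appended.\<close>

definition sorted_eigensystem :: "'n::finite cmat \<Rightarrow> nat \<Rightarrow> (nat \<Rightarrow> complex ^ 'n) \<Rightarrow> (nat \<Rightarrow> real) \<Rightarrow> bool"
  where "sorted_eigensystem X m u \<mu> \<longleftrightarrow>
    (\<forall>i<m. norm (u i) = 1 \<and> X *v u i = \<mu> i *\<^sub>R u i) \<and>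
    (\<forall>i<m. \<forall>j<m. i \<noteq> j \<longrightarrow> cinner (u i) (u j) = 0) \<and>
    (\<forall>i j. i \<le> j \<longrightarrow> j < m \<longrightarrow> \<mu> j \<le> \<mu> i) \<and>
    (\<forall>w. (\<forall>i<m. cinner (u i) w = 0) \<longrightarrow> (\<forall>j<m. Re (cinner w (X *v w)) \<le> \<mu> j * (norm w)\<^sup>2))"

lemma ex_sorted_eigensystem:
  fixes X :: "'n::finite cmat"
  assumes X: "hermitian X" and "m \<le> CARD('n)"
  shows "\<exists>u \<mu>. sorted_eigensystem X m u \<mu>"
  using assms(2)
proof (induction m)
  case 0
  then show ?case by (simp add: sorted_eigensystem_def)
next
  case (Suc m)
  then obtain u \<mu> where "sorted_eigensystem X m u \<mu>" by auto
  then have unit: "\<And>i. i < m \<Longrightarrow> norm (u i) = 1"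
    and eig: "\<And>i. i < m \<Longrightarrow> X *v u i = \<mu> i *\<^sub>R u i"
    and orth: "\<And>i j. i < m \<Longrightarrow> j < m \<Longrightarrow> i \<noteq> j \<Longrightarrow> cinner (u i) (u j) = 0"
    and dec: "\<And>i j. i \<le> j \<Longrightarrow> j < m \<Longrightarrow> \<mu> j \<le> \<mu> i"
    and bound: "\<And>w j. (\<And>i. i < m \<Longrightarrow> cinner (u i) w = 0) \<Longrightarrow> j < m \<Longrightarrow>
        Re (cinner w (X *v w)) \<le> \<mu> j * (norm w)\<^sup>2"
    unfolding sorted_eigensystem_def by blast+
  obtain v l where v: "norm v = 1" "X *v v = l *\<^sub>R v" "\<And>i. i < m \<Longrightarrow> cinner (u i) v = 0"
    and l: "\<And>w. (\<And>i. i < m \<Longrightarrow> cinner (u i) w = 0) \<Longrightarrow> Re (cinner w (X *v w)) \<le> l * (norm w)\<^sup>2"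
    using ex_next_eigenvector[where m = m and u = u and \<mu> = \<mu>, OF X _ eig] Suc.prems by (metis Suc_le_lessD)
  have v': "cinner v (u i) = 0" if "i < m" for i
    using v(3)[OF that] cnj_cinner[of "u i" v] by simp
  have l_le: "l \<le> \<mu> j" if "j < m" for j
    using bound[OF v(3) that] v(1,2) by (simp add: cinner_simps Re_cinner_self)
  show ?case
    by (rule exI[of _ "u(m := v)"], rule exI[of _ "\<mu>(m := l)"])
      (auto simp: sorted_eigensystem_def less_Suc_eq unit eig v v' orth dec l bound l_le)
qed

lemma cinner_column:
  "(ctrans U ** V) $ i $ j = cinner (column i U) (column j V)"
  by (simp add: matrix_matrix_mult_def cinner_def column_def)

text \<open>The index type \<open>'n\<close> carries no order, so "sorted" is meant along an enumeration \<open>d\<close> of it. Using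
  one \<open>d\<close> for two matrices makes their sorted eigenvalues comparable index by index.\<close>

lemma spectral_theorem_sorted:
  fixes X :: "'n::finite cmat" and d :: "nat \<Rightarrow> 'n"
  assumes X: "hermitian X" and d: "bij_betw d {..<CARD('n)} UNIV"
  obtains U \<mu> where "unitary U" "X = U ** diag_mat \<mu> ** ctrans U"
    "\<And>i j. i \<le> j \<Longrightarrow> j < CARD('n) \<Longrightarrow> \<mu> (d j) \<le> \<mu> (d i)"
proof -
  obtain u \<mu> where "sorted_eigensystem X CARD('n) u \<mu>"
    using ex_sorted_eigensystem[OF X order_refl] by blast
  then have unit: "\<And>i. i < CARD('n) \<Longrightarrow> norm (u i) = 1"
    and eig: "\<And>i. i < CARD('n) \<Longrightarrow> X *v u i = \<mu> i *\<^sub>R u i"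
    and orth: "\<And>i j. i < CARD('n) \<Longrightarrow> j < CARD('n) \<Longrightarrow> i \<noteq> j \<Longrightarrow> cinner (u i) (u j) = 0"
    and dec: "\<And>i j. i \<le> j \<Longrightarrow> j < CARD('n) \<Longrightarrow> \<mu> j \<le> \<mu> i"
    unfolding sorted_eigensystem_def by blast+
  define e where "e = inv_into {..<CARD('n)} d"
  have e: "e i < CARD('n)" for i
    using bij_betw_apply[OF bij_betw_inv_into[OF d], of i] by (simp add: e_def)
  have de: "d (e i) = i" for i
    unfolding e_def by (rule bij_betw_inv_into_right[OF d UNIV_I])
  have ed: "e (d i) = i" if "i < CARD('n)" for i
    using bij_betw_inv_into_left[OF d, of i] that by (simp add: e_def)
  have e_inj: "e i = e j \<longleftrightarrow> i = j" for i j by (metis de)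
  define U :: "'n cmat" where "U = (\<chi> i j. u (e j) $ i)"
  have col: "column j U = u (e j)" for j by (simp add: U_def column_def vec_eq_iff)
  have U: "unitary U"
    unfolding unitary_iff vec_eq_iff cinner_column
    using unit orth e by (auto simp: col mat_def cinner_self e_inj)
  have "X ** U = U ** diag_mat (\<mu> \<circ> e)"
  proof (simp only: vec_eq_iff, intro allI)
    fix i j
    have "(X ** U) $ i $ j = (X *v u (e j)) $ i"
      by (simp add: matrix_matrix_mult_def matrix_vector_mult_def U_def)
    also have "\<dots> = (U ** diag_mat (\<mu> \<circ> e)) $ i $ j"
      unfolding diag_mat_mult_right by (simp add: eig e U_def scaleR_conv_of_real[of _ "_ :: complex"] mult.commute)
    finally show "(X ** U) $ i $ j = (U ** diag_mat (\<mu> \<circ> e)) $ i $ j" .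
  qed
  then have "X ** (U ** ctrans U) = U ** diag_mat (\<mu> \<circ> e) ** ctrans U"
    by (simp add: matrix_mul_assoc)
  then have "X = U ** diag_mat (\<mu> \<circ> e) ** ctrans U" using U by (simp add: unitary_def)
  then show thesis using that[OF U] dec ed by simp
qed

section \<open>Symmetric norms: pinching and weak majorization\<close>

lemma symmetric_norm_unitary:
  assumes "symmetric_norm N" "unitary U" "unitary V"
  shows "N (U ** X ** V) = N X"
  using assms by (metis symmetric_norm_def)

lemma symmetric_norm_add: "symmetric_norm N \<Longrightarrow> N (X + Y) \<le> N X + N Y"
  by (simp add: symmetric_norm_def matrix_norm_def)

lemma symmetric_norm_scaleR:
  assumes "symmetric_norm N"
  shows "N (c *\<^sub>R X) = \<bar>c\<bar> * N X"
proof -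
  have "c *\<^sub>R X = map_matrix (\<lambda>x. complex_of_real c * x) X"
    by (simp add: vec_eq_iff map_matrix_def scaleR_conv_of_real[of _ "_ :: complex"])
  then show ?thesis using assms by (simp add: symmetric_norm_def matrix_norm_def)
qed

lemma unitary_mat_1: "unitary (mat 1)"
proof -
  have "ctrans (mat 1) = (mat 1 :: 'a cmat)" by (simp add: vec_eq_iff mat_def)
  then show ?thesis by (simp add: unitary_iff)
qed

lemma unitary_diag_sign:
  assumes "\<And>i. \<bar>s i\<bar> = 1"
  shows "unitary (diag_mat s)"
proof -
  have "s i * s i = 1" for i using assms[of i] by (metis abs_mult_self_eq mult_1)
  then show ?thesis
    unfolding unitary_iff ctrans_diag_mat vec_eq_iff diag_mat_mult_left
    by (simp add: diag_mat_def mat_def flip: of_real_mult)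
qed

text \<open>Discarding the off-diagonal entries does not increase a symmetric norm. They are removed one
  index \<open>a\<close> at a time: the mean of \<open>X\<close> and \<open>D X D\<close>, where the diagonal unitary \<open>D\<close> flips the
  sign of coordinate \<open>a\<close>, is \<open>X\<close> with row and column \<open>a\<close> cleared off the diagonal.\<close>

lemma pinching:
  fixes X :: "'n::finite cmat"
  assumes N: "symmetric_norm N"
  shows "N (\<chi> i j. if i = j then X $ i $ j else 0) \<le> N X"
proof -
  define P where "P S = (\<chi> i j. if i \<noteq> j \<and> (i \<in> S \<or> j \<in> S) then 0 else X $ i $ j)" for S :: "'n set"
  have "N (P S) \<le> N X" for S
    using finite[of S]
  proof (induction S rule: finite_induct)
    case empty
    have "P {} = X" by (simp add: P_def vec_eq_iff)
    then show ?case by simp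
  next
    case (insert a S)
    define D where "D = diag_mat (\<lambda>i. if i = a then -1 else 1 :: real)"
    have D: "unitary D" unfolding D_def by (rule unitary_diag_sign) auto
    have "P (insert a S) = (1 / 2) *\<^sub>R (P S + D ** P S ** D)"
      unfolding vec_eq_iff D_def vector_scaleR_component vector_add_component
        diag_mat_mult_right diag_mat_mult_left
      by (auto simp: P_def)
    then have "N (P (insert a S)) \<le> (1 / 2) * (N (P S) + N (D ** P S ** D))"
      using symmetric_norm_add[OF N, of "P S" "D ** P S ** D"] by (simp add: symmetric_norm_scaleR[OF N])
    also have "\<dots> = N (P S)" by (simp add: symmetric_norm_unitary[OF N D D])
    finally show ?case using insert by simp
  qed
  moreover have "P UNIV = (\<chi> i j. if i = j then X $ i $ j else 0)"
    by (simp add: P_def vec_eq_iff)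
  ultimately show ?thesis by metis
qed

lemma symmetric_norm_signed_permutation:
  fixes y s :: "'n::finite \<Rightarrow> real"
  assumes N: "symmetric_norm N" and s: "\<And>i. \<bar>s i\<bar> = 1" and \<sigma>: "bij \<sigma>"
  shows "N (diag_mat (\<lambda>i. s i * y (\<sigma> i))) = N (diag_mat y)"
proof -
  define Q :: "'n cmat" where "Q = (\<chi> i j. if j = \<sigma> i then 1 else 0)"
  have inj: "\<sigma> i = \<sigma> j \<longleftrightarrow> i = j" for i j using \<sigma> by (meson bij_is_inj inj_eq)
  have "Q ** ctrans Q = mat 1"
    by (auto simp: vec_eq_iff Q_def matrix_matrix_mult_def mat_def inj
        if_distrib [where f = "\<lambda>x. x * _"] if_distrib [where f = cnj] cong: if_cong)
  then have Q: "unitary Q" by (simp add: unitary_def matrix_left_right_inverse)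
  have times_Q: "(M ** ctrans Q) $ i $ j = M $ i $ \<sigma> j" for M i j
    by (simp add: matrix_matrix_mult_def Q_def if_distrib [where f = cnj]
        if_distrib [where f = "\<lambda>x. _ * x"] cong: if_cong)
  have "diag_mat s ** (Q ** diag_mat y ** ctrans Q) = diag_mat (\<lambda>i. s i * y (\<sigma> i))"
    unfolding vec_eq_iff diag_mat_mult_left times_Q diag_mat_mult_right
    by (simp add: diag_mat_def Q_def inj)
  then have "N (diag_mat (\<lambda>i. s i * y (\<sigma> i)))
      = N (diag_mat s ** (Q ** diag_mat y ** ctrans Q) ** mat 1)" by simp
  also have "\<dots> = N (diag_mat y)"
    by (simp only: symmetric_norm_unitary[OF N] unitary_mat_1 unitary_diag_sign s Q unitary_ctrans)
  finally show ?thesis .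
qed

text \<open>The Ky Fan dominance principle on diagonal matrices. The vector \<open>x\<close> lies in the convex hull
  of the signed permutations of \<open>y\<close>: a separating functional would violate
  \<open>sum_mult_le_reordered\<close>. All these signed permutations have the norm of \<open>y\<close>, and the ball of
  that radius is convex.\<close>

lemma diag_norm_mono_weak_majorization:
  fixes x y :: "'n::finite \<Rightarrow> real"
  assumes N: "symmetric_norm N" and d: "bij_betw d {..<CARD('n)} UNIV"
    and x_dec: "\<And>i j. i \<le> j \<Longrightarrow> j < CARD('n) \<Longrightarrow> x (d j) \<le> x (d i)"
    and x_nn: "\<And>i. 0 \<le> x i"
    and le: "\<And>k. k \<le> CARD('n) \<Longrightarrow> (\<Sum>j<k. x (d j)) \<le> (\<Sum>j<k. y (d j))"
  shows "N (diag_mat x) \<le> N (diag_mat y)"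
proof -
  \<comment> \<open>Signs are indexed by booleans, which makes the set of signed permutations visibly finite.\<close>
  define sg where "sg b = (if b then 1 else -1 :: real)" for b
  define S :: "(real ^ 'n) set" where
    "S = (\<lambda>(b, \<sigma>). \<chi> i. sg (b i) * y (\<sigma> i)) ` (UNIV \<times> {\<sigma>. bij \<sigma>})"
  have S_I: "(\<chi> i. sg (b i) * y (\<sigma> i)) \<in> S" if "bij \<sigma>" for b \<sigma>
    using that by (auto simp: S_def)
  have "finite S" by (simp add: S_def)
  have "(\<chi> i. x i) \<in> convex hull S"
  proof (rule ccontr)
    assume "(\<chi> i. x i) \<notin> convex hull S"
    then obtain a b where ab: "a \<bullet> (\<chi> i. x i) < b" "\<And>z. z \<in> convex hull S \<Longrightarrow> b < a \<bullet> z"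
      using separating_hyperplane_closed_point[of "convex hull S" "\<chi> i. x i"]
        compact_imp_closed[OF finite_imp_compact_convex_hull[OF \<open>finite S\<close>]] convex_convex_hull by blast
    define c where "c i = - a $ i" for i
    have c: "(\<Sum>i\<in>UNIV. c i * z $ i) = - (a \<bullet> z)" for z
      by (simp add: c_def inner_vec_def sum_negf)
    obtain \<pi> where \<pi>: "bij_betw \<pi> {..<CARD('n)} {..<CARD('n)}"
      and upper: "(\<Sum>j<CARD('n). c (d j) * x (d j)) \<le> (\<Sum>j<CARD('n). \<bar>c (d (\<pi> j))\<bar> * y (d j))"
      using sum_mult_le_reordered[of "CARD('n)" "\<lambda>j. x (d j)" "\<lambda>j. y (d j)" "\<lambda>j. c (d j)"]
        x_dec x_nn le by blast
    have d\<pi>: "bij_betw (d \<circ> \<pi>) {..<CARD('n)} UNIV" by (rule bij_betw_trans[OF \<pi> d])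
    define \<sigma> where "\<sigma> = d \<circ> inv_into {..<CARD('n)} (d \<circ> \<pi>)"
    have \<sigma>: "bij \<sigma>"
      unfolding \<sigma>_def by (rule bij_betw_trans[OF bij_betw_inv_into[OF d\<pi>] d])
    have \<sigma>_d\<pi>: "\<sigma> (d (\<pi> j)) = d j" if "j < CARD('n)" for j
      using bij_betw_inv_into_left[OF d\<pi>, of j] that by (simp add: \<sigma>_def)
    \<comment> \<open>The signed permutation of \<open>y\<close> on which the functional \<open>c\<close> attains the upper bound.\<close>
    define z :: "real ^ 'n" where "z = (\<chi> i. sg (0 \<le> c i) * y (\<sigma> i))"
    have "z \<in> S" unfolding z_def by (rule S_I[OF \<sigma>])
    have "- (a \<bullet> (\<chi> i. x i)) = (\<Sum>i\<in>UNIV. c i * x i)" by (simp flip: c)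
    also have "\<dots> = (\<Sum>j<CARD('n). c (d j) * x (d j))"
      by (rule sum.reindex_bij_betw[OF d, symmetric])
    also note upper
    also have "(\<Sum>j<CARD('n). \<bar>c (d (\<pi> j))\<bar> * y (d j))
        = (\<Sum>j<CARD('n). \<bar>c ((d \<circ> \<pi>) j)\<bar> * y (\<sigma> ((d \<circ> \<pi>) j)))"
      by (simp add: \<sigma>_d\<pi>)
    also have "\<dots> = (\<Sum>i\<in>UNIV. \<bar>c i\<bar> * y (\<sigma> i))"
      by (rule sum.reindex_bij_betw[OF d\<pi>])
    also have "\<dots> = (\<Sum>i\<in>UNIV. c i * z $ i)"
      by (intro sum.cong) (auto simp: z_def sg_def)
    also have "\<dots> = - (a \<bullet> z)" by (rule c)
    finally show False using ab(1) ab(2)[OF hull_inc[OF \<open>z \<in> S\<close>]] by simp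
  qed
  also have "convex hull S \<subseteq> {z. N (diag_mat (\<lambda>i. z $ i)) \<le> N (diag_mat y)}"
  proof (rule hull_minimal)
    show "S \<subseteq> {z. N (diag_mat (\<lambda>i. z $ i)) \<le> N (diag_mat y)}"
    proof
      fix z assume "z \<in> S"
      then obtain b \<sigma> where "bij \<sigma>" and z: "z = (\<chi> i. sg (b i) * y (\<sigma> i))"
        by (auto simp: S_def)
      then have "N (diag_mat (\<lambda>i. sg (b i) * y (\<sigma> i))) = N (diag_mat y)"
        by (intro symmetric_norm_signed_permutation[OF N]) (auto simp: sg_def)
      then show "z \<in> {z. N (diag_mat (\<lambda>i. z $ i)) \<le> N (diag_mat y)}"
        unfolding z by (simp add: vec_lambda_inverse)
    qed
    show "convex {z. N (diag_mat (\<lambda>i. z $ i)) \<le> N (diag_mat y)}"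
    proof (rule convexI)
      fix v w :: "real ^ 'n" and s t :: real
      assume "v \<in> {z. N (diag_mat (\<lambda>i. z $ i)) \<le> N (diag_mat y)}"
        and "w \<in> {z. N (diag_mat (\<lambda>i. z $ i)) \<le> N (diag_mat y)}"
        and st: "0 \<le> s" "0 \<le> t" "s + t = 1"
      then have v: "N (diag_mat (($) v)) \<le> N (diag_mat y)" and w: "N (diag_mat (($) w)) \<le> N (diag_mat y)"
        by simp_all
      have "diag_mat (\<lambda>i. s * v $ i + t * w $ i) = s *\<^sub>R diag_mat (($) v) + t *\<^sub>R diag_mat (($) w)"
        by (simp add: vec_eq_iff diag_mat_def scaleR_conv_of_real[of _ "_ :: complex"])
      then have "N (diag_mat (\<lambda>i. s * v $ i + t * w $ i)) \<le> s * N (diag_mat (($) v)) + t * N (diag_mat (($) w))"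
        using symmetric_norm_add[OF N] st by (metis symmetric_norm_scaleR[OF N] abs_of_nonneg)
      also have "\<dots> \<le> s * N (diag_mat y) + t * N (diag_mat y)"
        using v w st by (intro add_mono mult_left_mono) auto
      also have "\<dots> = N (diag_mat y)" using st by (simp flip: distrib_right)
      finally show "s *\<^sub>R v + t *\<^sub>R w \<in> {z. N (diag_mat (\<lambda>i. z $ i)) \<le> N (diag_mat y)}"
        unfolding mem_Collect_eq vector_add_component vector_scaleR_component real_scaleR_def .
    qed
  qed
  finally show ?thesis by (simp add: vec_lambda_inverse)
qed

section \<open>Expansive congruences of diagonal matrices\<close>

lemma cinner_diag_mat:
  "cinner v (diag_mat a *v v) = of_real (\<Sum>i\<in>UNIV. a i * (cmod (v $ i))\<^sup>2)"
proof -
  have "(diag_mat a *v v) $ i = of_real (a i) * v $ i" for i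
    by (simp add: matrix_vector_mult_def diag_mat_def if_distrib [where f = "\<lambda>x. x * _"] cong: if_cong)
  then show ?thesis
    by (simp add: cinner_def complex_norm_square mult_ac del: of_real_power)
qed

lemma sum_axis: "(\<Sum>i\<in>UNIV. g i * (cmod (axis j 1 $ i))\<^sup>2) = g j"
proof -
  have "(\<Sum>i\<in>UNIV. g i * (cmod (axis j 1 $ i))\<^sup>2) = (\<Sum>i\<in>UNIV. if i = j then g i else 0)"
    by (intro sum.cong) (auto simp: axis_def)
  then show ?thesis by simp
qed

lemma norm_square_sum: "(norm v)\<^sup>2 = (\<Sum>i\<in>UNIV. (cmod (v $ i))\<^sup>2)"
  by (simp add: norm_vec_def L2_set_def sum_nonneg)

text \<open>Eigenvalues do not decrease under an expansive congruence. The hypothesis \<open>form\<close> is the identity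
  \<open>G\<^sup>* D\<^sub>a G = D\<^sub>\<mu>\<close> read as an equality of quadratic forms. There is a unit vector \<open>v\<close> with no
  component before \<open>k\<close> whose image \<open>G v\<close> has no component after \<open>k\<close>, as this imposes
  only \<open>n - 1\<close> equations. At \<open>v\<close> the form is at most \<open>\<mu> (d k)\<close>, and at least
  \<open>a (d k) * \<parallel>G v\<parallel>\<^sup>2\<close>.\<close>

lemma diag_congruence_eigenvalue_le:
  fixes G :: "'n::finite cmat" and a \<mu> :: "'n \<Rightarrow> real"
  assumes d: "bij_betw d {..<CARD('n)} UNIV"
    and a_dec: "\<And>i j. i \<le> j \<Longrightarrow> j < CARD('n) \<Longrightarrow> a (d j) \<le> a (d i)" and a_nn: "\<And>i. 0 \<le> a i"
    and mu_dec: "\<And>i j. i \<le> j \<Longrightarrow> j < CARD('n) \<Longrightarrow> \<mu> (d j) \<le> \<mu> (d i)"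
    and form: "\<And>v. (\<Sum>i\<in>UNIV. a i * (cmod ((G *v v) $ i))\<^sup>2) = (\<Sum>j\<in>UNIV. \<mu> j * (cmod (v $ j))\<^sup>2)"
    and exp: "\<And>v. norm v \<le> norm (G *v v)"
    and k: "k < CARD('n)"
  shows "a (d k) \<le> \<mu> (d k)"
proof -
  define R where "R i = (\<chi> j. cnj (G $ d i $ j))" for i
  define S where "S = (\<lambda>i. axis (d i) 1) ` {..<k} \<union> R ` {k<..<CARD('n)}"
  have "card S \<le> card {..<k} + card {k<..<CARD('n)}"
    unfolding S_def by (rule order_trans[OF card_Un_le]) (intro add_mono card_image_le; simp)
  also have "\<dots> < CARD('n)" using k by simp
  finally obtain v where v: "norm v = 1" "\<And>w. w \<in> S \<Longrightarrow> cinner w v = 0"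
    using ex_unit_vector_annihilated[of S] by (auto simp: S_def)
  have v0: "v $ d i = 0" if "i < k" for i
  proof -
    have "cinner (axis (d i) 1) v = v $ d i"
      by (simp add: cinner_def axis_def if_distrib [where f = "\<lambda>x. x * _"] if_distrib [where f = cnj] cong: if_cong)
    then show ?thesis using v(2)[of "axis (d i) 1"] that by (simp add: S_def)
  qed
  have Gv0: "(G *v v) $ d i = 0" if "k < i" "i < CARD('n)" for i
  proof -
    have "cinner (R i) v = (G *v v) $ d i" by (simp add: cinner_def R_def matrix_vector_mult_def)
    then show ?thesis using v(2)[of "R i"] that by (simp add: S_def)
  qed
  have "a (d k) * 1 \<le> a (d k) * (norm (G *v v))\<^sup>2"
    using exp[of v] v(1) a_nn by (intro mult_left_mono) auto
  also have "\<dots> = (\<Sum>i<CARD('n). a (d k) * (cmod ((G *v v) $ d i))\<^sup>2)"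
    by (simp add: norm_square_sum sum_distrib_left flip: sum.reindex_bij_betw[OF d])
  also have "\<dots> \<le> (\<Sum>i<CARD('n). a (d i) * (cmod ((G *v v) $ d i))\<^sup>2)"
  proof (rule sum_mono)
    fix i assume "i \<in> {..<CARD('n)}"
    then show "a (d k) * (cmod ((G *v v) $ d i))\<^sup>2 \<le> a (d i) * (cmod ((G *v v) $ d i))\<^sup>2"
      using Gv0[of i] a_dec[of i k] k by (cases "k < i") (auto intro: mult_right_mono)
  qed
  also have "\<dots> = (\<Sum>i\<in>UNIV. a i * (cmod ((G *v v) $ i))\<^sup>2)"
    by (rule sum.reindex_bij_betw[OF d])
  also have "\<dots> = (\<Sum>i<CARD('n). \<mu> (d i) * (cmod (v $ d i))\<^sup>2)"
    unfolding form by (rule sum.reindex_bij_betw[OF d, symmetric])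
  also have "\<dots> \<le> (\<Sum>i<CARD('n). \<mu> (d k) * (cmod (v $ d i))\<^sup>2)"
  proof (rule sum_mono)
    fix i assume "i \<in> {..<CARD('n)}"
    then show "\<mu> (d i) * (cmod (v $ d i))\<^sup>2 \<le> \<mu> (d k) * (cmod (v $ d i))\<^sup>2"
      using v0[of i] mu_dec[of k i] by (cases "i < k") (auto intro: mult_right_mono)
  qed
  also have "\<dots> = \<mu> (d k) * (norm v)\<^sup>2"
    by (simp add: norm_square_sum sum_distrib_left flip: sum.reindex_bij_betw[OF d])
  finally show ?thesis using v(1) by simp
qed

text \<open>Bessel's inequality for the columns of \<open>D\<^sub>a\<^sup>1\<^sup>/\<^sup>2 G D\<^sub>\<mu>\<^sup>-\<^sup>1\<^sup>/\<^sup>2\<close>, which are orthonormal where \<open>\<mu>\<close> is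
  positive. The test vector \<open>v\<close> is chosen so that \<open>(G v)\<^sub>i\<close> and the form at \<open>v\<close> are both the
  sum \<open>T\<close>; keeping only the term \<open>i\<close> of the form leaves \<open>a i * T\<^sup>2 \<le> T\<close>.\<close>

lemma diag_congruence_row_sum_le_1:
  fixes G :: "'n::finite cmat" and a \<mu> :: "'n \<Rightarrow> real"
  assumes a_nn: "\<And>i. 0 \<le> a i" and mu_nn: "\<And>i. 0 \<le> \<mu> i"
    and form: "\<And>v. (\<Sum>i\<in>UNIV. a i * (cmod ((G *v v) $ i))\<^sup>2) = (\<Sum>j\<in>UNIV. \<mu> j * (cmod (v $ j))\<^sup>2)"
  shows "(\<Sum>j\<in>UNIV. a i * (cmod (G $ i $ j))\<^sup>2 / \<mu> j) \<le> 1"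
proof -
  define T where "T = (\<Sum>j\<in>UNIV. (cmod (G $ i $ j))\<^sup>2 / \<mu> j)"
  define v where "v = (\<chi> j. cnj (G $ i $ j) / of_real (\<mu> j))"
  have T_nn: "0 \<le> T" unfolding T_def using mu_nn by (intro sum_nonneg) auto
  have "(G *v v) $ i = of_real T"
    by (simp add: matrix_vector_mult_def v_def T_def complex_norm_square del: of_real_power)
  then have "a i * T\<^sup>2 = a i * (cmod ((G *v v) $ i))\<^sup>2" by simp
  also have "\<dots> \<le> (\<Sum>k\<in>UNIV. a k * (cmod ((G *v v) $ k))\<^sup>2)"
    using a_nn by (intro member_le_sum) auto
  also have "\<dots> = (\<Sum>j\<in>UNIV. \<mu> j * (cmod (v $ j))\<^sup>2)" by (rule form)
  also have "\<dots> = T"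
    unfolding T_def
    by (intro sum.cong refl) (simp add: v_def norm_divide power_divide power2_eq_square)
  finally have "(a i * T) * T \<le> 1 * T" by (simp add: power2_eq_square mult_ac)
  then have "a i * T \<le> 1"
    using T_nn by (cases "T = 0") (auto dest: mult_right_le_imp_le)
  then show ?thesis by (simp add: T_def sum_distrib_left)
qed

lemma norm_unitary_mult:
  assumes "unitary U"
  shows "norm (U *v v) = norm v"
proof -
  have "Re (cinner (U *v v) (U *v v)) = Re (cinner v v)"
    using assms by (simp add: cinner_matrix matrix_vector_mul_assoc unitary_def)
  then show ?thesis by (simp add: Re_cinner_self)
qed

lemma norm_expansive_mult:
  assumes "expansive Z"
  shows "norm v \<le> norm (Z *v v)"
proof -
  have "0 \<le> Re (cinner v ((ctrans Z ** Z - mat 1) *v v))"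
    using assms by (simp add: expansive_def loewner_le_def psd_iff)
  also have "cinner v ((ctrans Z ** Z - mat 1) *v v) = cinner (Z *v v) (Z *v v) - cinner v v"
    by (simp add: matrix_vector_mult_diff_rdistrib cinner_simps cinner_matrix[of v "ctrans Z"]
        flip: matrix_vector_mul_assoc)
  finally show ?thesis by (simp add: Re_cinner_self)
qed

section \<open>The norm inequality\<close>

text \<open>The theorem in coordinates: \<open>A\<close> and \<open>Z\<^sup>* A Z\<close> are diagonal, in bases that differ by unitaries
  absorbed in \<open>G\<close>. The squared moduli of the entries of \<open>G\<close> are the weights of
  \<open>weighted_concave_sums\<close>, which compares \<open>f \<circ> \<mu>\<close> with the diagonal \<open>y\<close> of the matrix on the right.\<close>

lemma symmetric_norm_concave_diag:
  fixes f :: "real \<Rightarrow> real" and G :: "'n::finite cmat" and a \<mu> :: "'n \<Rightarrow> real"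
  assumes conc: "concave_on {0..} f" and nonneg: "\<And>x. 0 \<le> x \<Longrightarrow> 0 \<le> f x"
    and N: "symmetric_norm N"
    and d: "bij_betw d {..<CARD('n)} UNIV"
    and a_dec: "\<And>i j. i \<le> j \<Longrightarrow> j < CARD('n) \<Longrightarrow> a (d j) \<le> a (d i)" and a_nn: "\<And>i. 0 \<le> a i"
    and mu_dec: "\<And>i j. i \<le> j \<Longrightarrow> j < CARD('n) \<Longrightarrow> \<mu> (d j) \<le> \<mu> (d i)"
    and cong: "ctrans G ** diag_mat a ** G = diag_mat \<mu>"
    and exp: "\<And>v. norm v \<le> norm (G *v v)"
  shows "N (diag_mat (f \<circ> \<mu>)) \<le> N (ctrans G ** diag_mat (f \<circ> a) ** G)"
proof -
  have form: "(\<Sum>i\<in>UNIV. a i * (cmod ((G *v v) $ i))\<^sup>2) = (\<Sum>j\<in>UNIV. \<mu> j * (cmod (v $ j))\<^sup>2)" for v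
  proof -
    have "cinner (G *v v) (diag_mat a *v (G *v v)) = cinner v (diag_mat \<mu> *v v)"
      by (simp add: cinner_matrix[of v "ctrans G"] flip: cong matrix_vector_mul_assoc)
    then show ?thesis by (simp only: cinner_diag_mat of_real_eq_iff)
  qed
  have le: "a (d i) \<le> \<mu> (d i)" if "i < CARD('n)" for i
    by (rule diag_congruence_eigenvalue_le[OF d a_dec a_nn mu_dec form exp that])
  have mu_nn: "0 \<le> \<mu> i" for i
  proof -
    obtain j where "j < CARD('n)" "i = d j" using d by (auto simp: bij_betw_def)
    then show ?thesis using le[of j] a_nn[of i] by simp
  qed
  define y where "y j = (\<Sum>i\<in>UNIV. f (a i) * (cmod (G $ i $ j))\<^sup>2)" for j
  have column: "(\<Sum>i<CARD('n). g (d i) * (cmod (G $ d i $ j))\<^sup>2)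
      = (\<Sum>i\<in>UNIV. g i * (cmod ((G *v axis j 1) $ i))\<^sup>2)" for g j
    using sum.reindex_bij_betw[OF d, of "\<lambda>i. g i * (cmod (G $ i $ j))\<^sup>2"]
    by (simp add: matrix_vector_mult_def axis_def if_distrib [where f = "\<lambda>x. _ * x"] cong: if_cong)
  have "(\<Sum>j<k. f (\<mu> (d j))) \<le> (\<Sum>j<k. y (d j))" if k: "k \<le> CARD('n)" for k
  proof -
    have "(\<Sum>j<k. f (\<mu> (d j))) \<le> (\<Sum>j<k. \<Sum>i<CARD('n). f (a (d i)) * (cmod (G $ d i $ d j))\<^sup>2)"
    proof (rule weighted_concave_sums[OF conc nonneg])
      fix j
      have "(\<Sum>i\<in>UNIV. \<mu> i * (cmod (axis (d j) 1 $ i :: complex))\<^sup>2) = \<mu> (d j)"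
        by (rule sum_axis)
      then show "(\<Sum>i<CARD('n). a (d i) * (cmod (G $ d i $ d j))\<^sup>2) = \<mu> (d j)"
        unfolding column form .
      show "1 \<le> (\<Sum>i<CARD('n). (cmod (G $ d i $ d j))\<^sup>2)"
        using column[of "\<lambda>_. 1" "d j"] exp[of "axis (d j) 1"]
        by (simp add: norm_axis_1 flip: norm_square_sum)
      show "(\<Sum>i<CARD('n). a (d j) * (cmod (G $ d j $ d i))\<^sup>2 / \<mu> (d i)) \<le> 1"
        unfolding sum.reindex_bij_betw[OF d, of "\<lambda>i. a (d j) * (cmod (G $ d j $ i))\<^sup>2 / \<mu> i"]
        by (rule diag_congruence_row_sum_le_1[OF a_nn mu_nn form])
    qed (use a_dec mu_dec le a_nn k in auto)
    then show ?thesis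
      unfolding y_def
      using sum.reindex_bij_betw[OF d, of "\<lambda>i. f (a i) * (cmod (G $ i $ j))\<^sup>2" for j] by simp
  qed
  then have "N (diag_mat (f \<circ> \<mu>)) \<le> N (diag_mat y)"
    using concave_nonneg_mono[OF conc nonneg] mu_dec mu_nn nonneg
    by (intro diag_norm_mono_weak_majorization[OF N d]) auto
  also have "diag_mat y = (\<chi> i j. if i = j then (ctrans G ** diag_mat (f \<circ> a) ** G) $ i $ j else 0)"
    by (simp add: vec_eq_iff diag_mat_def[of y] y_def complex_norm_square mult_ac
        matrix_matrix_mult_def[of _ G] diag_mat_mult_right del: of_real_power)
  also have "N \<dots> \<le> N (ctrans G ** diag_mat (f \<circ> a) ** G)" by (rule pinching[OF N])
  finally show ?thesis .
qed

theorem theorem2p1: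
  fixes f :: "real \<Rightarrow> real" and A Z :: "complex ^ 'n::finite ^ 'n"
    and N :: "complex ^ 'n ^ 'n \<Rightarrow> real"
  assumes "concave_on {0..} f" and "\<And>x. 0 \<le> x \<Longrightarrow> 0 \<le> f x"
    and "psd A" and "expansive Z" and "symmetric_norm N"
  shows "N (mat_fun f (ctrans Z ** A ** Z)) \<le> N (ctrans Z ** mat_fun f A ** Z)"
proof -
  obtain d :: "nat \<Rightarrow> 'n" where d: "bij_betw d {..<CARD('n)} UNIV"
    using ex_bij_betw_nat_finite[of "UNIV :: 'n set"] by (auto simp: atLeast0LessThan)
  have B: "psd (ctrans Z ** A ** Z)" by (rule psd_congruence[OF assms(3)])
  obtain V a where V: "unitary V" and A: "A = V ** diag_mat a ** ctrans V"
    and a_dec: "\<And>i j. i \<le> j \<Longrightarrow> j < CARD('n) \<Longrightarrow> a (d j) \<le> a (d i)"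
    using spectral_theorem_sorted[OF _ d, of A] assms(3) by (auto simp: psd_iff)
  obtain U \<mu> where U: "unitary U" and ZAZ: "ctrans Z ** A ** Z = U ** diag_mat \<mu> ** ctrans U"
    and mu_dec: "\<And>i j. i \<le> j \<Longrightarrow> j < CARD('n) \<Longrightarrow> \<mu> (d j) \<le> \<mu> (d i)"
    using spectral_theorem_sorted[OF _ d, of "ctrans Z ** A ** Z"] B by (auto simp: psd_iff)
  have UU: "ctrans U ** U = mat 1" and VV: "ctrans V ** V = mat 1"
    using U V by (auto simp: unitary_def)
  define G where "G = ctrans V ** Z ** U"
  have G: "ctrans G ** diag_mat b ** G = ctrans U ** (ctrans Z ** (V ** diag_mat b ** ctrans V) ** Z) ** U" for b
    by (simp add: G_def ctrans_mult matrix_mul_assoc)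
  have "ctrans G ** diag_mat a ** G = (ctrans U ** U) ** diag_mat \<mu> ** (ctrans U ** U)"
    unfolding G A[symmetric] ZAZ by (simp only: matrix_mul_assoc)
  then have cong: "ctrans G ** diag_mat a ** G = diag_mat \<mu>" by (simp add: UU)
  have exp: "norm v \<le> norm (G *v v)" for v
    using norm_expansive_mult[OF assms(4), of "U *v v"]
    by (simp add: G_def norm_unitary_mult U unitary_ctrans[OF V] flip: matrix_vector_mul_assoc)
  have a_nn: "0 \<le> a i" for i
  proof -
    have "ctrans V ** A ** V = (ctrans V ** V) ** diag_mat a ** (ctrans V ** V)"
      unfolding A by (simp only: matrix_mul_assoc)
    then have "psd (diag_mat a)" using psd_congruence[OF assms(3), of V] by (simp add: VV)
    then have "0 \<le> Re (cinner (axis i 1) (diag_mat a *v axis i 1))" by (simp add: psd_iff)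
    then show ?thesis by (simp add: cinner_diag_mat sum_axis)
  qed
  have "N (mat_fun f (ctrans Z ** A ** Z)) = N (diag_mat (f \<circ> \<mu>))"
    unfolding ZAZ mat_fun_spectral[OF U]
    by (rule symmetric_norm_unitary[OF assms(5) U unitary_ctrans[OF U]])
  also have "\<dots> \<le> N (ctrans G ** diag_mat (f \<circ> a) ** G)"
    by (rule symmetric_norm_concave_diag[OF assms(1,2,5) d a_dec a_nn mu_dec cong exp])
  also have "\<dots> = N (ctrans Z ** mat_fun f A ** Z)"
    unfolding G unfolding A mat_fun_spectral[OF V]
    by (rule symmetric_norm_unitary[OF assms(5) unitary_ctrans[OF U] U])
  finally show ?thesis .
qed

end
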